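(* Let $c\ge 2$ and let $G$ be a graph with a $\nu$-equitable $c$-coloring with every color class of size $m$. If $\nu\ge m(c-1)/c$, then $G$ is Hoffman colorable and $\chi(G)=c$.
   Context: All graphs are finite, simple and undirected. A proper vertex coloring of a (necessarily regular) graph $G$ is called $\nu$-equitable if every vertex is adjacent to precisely $\nu$ vertices of every color other than its own. $\lambda_{\max}(G)$ and $\lambda_{\min}(G)$ denote the largest and smallest eigenvalues of the adjacency matrix of $G$; $\chi(G)$ is the chromatic number. For a graph with at least one edge, Hoffman's bound states $\chi(G)\ge h(G):=1-\lambda_{\max}(G)/\lambda_{\min}(G)$. A connected graph $G$ with at least one edge is called Hoffman colorable if $\chi(G)=h(G)$ (without rounding). A disconnected graph is called Hoffman colorable if every connected component is Hoffman colorable and the values $\lambda_{\max}$, $\lambda_{\min}$ and $\chi$ are the same for all components. Color classes are non-empty, so $m\ge 1$. *)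

theory Defs
  imports "Jordan_Normal_Form.Char_Poly" "Graph_Theory.Digraph_Component"
begin

text \<open>
  Finite simple undirected graphs are the finite, symmetric, loop-free digraphs without
  parallel arcs of locale \<^locale>\<open>graph\<close>; each undirected edge is a pair of opposite arcs.
  For such graphs the connected components are exactly the strongly connected components
  \<^const>\<open>pre_digraph.sccs\<close>, which are taken as (induced) subgraphs.
\<close>

definition proper_coloring :: "('v, 'e) pre_digraph \<Rightarrow> ('v \<Rightarrow> nat) \<Rightarrow> bool" where
  "proper_coloring G f \<longleftrightarrow>
     (\<forall>u \<in> verts G. \<forall>v \<in> verts G. u \<rightarrow>\<^bsub>G\<^esub> v \<longrightarrow> f u \<noteq> f v)"

definition color_class :: "('v, 'e) pre_digraph \<Rightarrow> ('v \<Rightarrow> nat) \<Rightarrow> nat \<Rightarrow> 'v set" where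
  "color_class G f i = {v \<in> verts G. f v = i}"

text \<open>All \<open>k\<close> colors \<open>0, \<dots>, k - 1\<close> are used, so color classes are non-empty.\<close>

definition coloring :: "('v, 'e) pre_digraph \<Rightarrow> nat \<Rightarrow> ('v \<Rightarrow> nat) \<Rightarrow> bool" where
  "coloring G k f \<longleftrightarrow> proper_coloring G f \<and> f ` verts G = {..<k}"

definition equitable_coloring ::
    "('v, 'e) pre_digraph \<Rightarrow> nat \<Rightarrow> nat \<Rightarrow> ('v \<Rightarrow> nat) \<Rightarrow> bool" where
  "equitable_coloring G \<nu> k f \<longleftrightarrow> coloring G k f \<and>
     (\<forall>v \<in> verts G. \<forall>i < k. i \<noteq> f v \<longrightarrow>
        card {w \<in> color_class G f i. v \<rightarrow>\<^bsub>G\<^esub> w} = \<nu>)"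

definition chromatic_number :: "('v, 'e) pre_digraph \<Rightarrow> nat" where
  "chromatic_number G = (LEAST k. \<exists>f. coloring G k f)"

text \<open>
  Matrices are indexed by \<open>0, \<dots>, n - 1\<close>, so the vertices have to be enumerated. Different
  enumerations give matrices that are conjugate by a permutation matrix, hence the
  eigenvalues do not depend on the choice.
\<close>

definition vertex_list :: "('v, 'e) pre_digraph \<Rightarrow> 'v list" where
  "vertex_list G = (SOME vs. distinct vs \<and> set vs = verts G)"

definition adjacency_matrix :: "('v, 'e) pre_digraph \<Rightarrow> real mat" where
  "adjacency_matrix G = mat (card (verts G)) (card (verts G))
     (\<lambda>(i, j). if vertex_list G ! i \<rightarrow>\<^bsub>G\<^esub> vertex_list G ! j then 1 else 0)"

text \<open>
  The adjacency matrix is real symmetric, so its real eigenvalues are all its eigenvalues.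
\<close>

definition lambda_max :: "('v, 'e) pre_digraph \<Rightarrow> real" where
  "lambda_max G = Max {k. eigenvalue (adjacency_matrix G) k}"

definition lambda_min :: "('v, 'e) pre_digraph \<Rightarrow> real" where
  "lambda_min G = Min {k. eigenvalue (adjacency_matrix G) k}"

definition hoffman_bound :: "('v, 'e) pre_digraph \<Rightarrow> real" where
  "hoffman_bound G = 1 - lambda_max G / lambda_min G"

definition connected_hoffman_colorable :: "('v, 'e) pre_digraph \<Rightarrow> bool" where
  "connected_hoffman_colorable G \<longleftrightarrow>
     Digraph_Component.connected G \<and> arcs G \<noteq> {} \<and>
     real (chromatic_number G) = hoffman_bound G"

text \<open>The null graph is neither connected nor regarded as Hoffman colorable.\<close>

definition disconnected_hoffman_colorable :: "('v, 'e) pre_digraph \<Rightarrow> bool" where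
  "disconnected_hoffman_colorable G \<longleftrightarrow>
     verts G \<noteq> {} \<and> \<not> Digraph_Component.connected G \<and>
     (\<forall>H \<in> pre_digraph.sccs G. connected_hoffman_colorable H) \<and>
     (\<forall>H \<in> pre_digraph.sccs G. \<forall>H' \<in> pre_digraph.sccs G.
        lambda_max H = lambda_max H' \<and> lambda_min H = lambda_min H' \<and>
        chromatic_number H = chromatic_number H')"

definition hoffman_colorable :: "('v, 'e) pre_digraph \<Rightarrow> bool" where
  "hoffman_colorable G \<longleftrightarrow>
     connected_hoffman_colorable G \<or> disconnected_hoffman_colorable G"

end

theory Submission
  imports Defs
begin

text \<open>Let A be the adjacency matrix. The color classes form an equitable partition, so A maps
  class functions (those constant on each class) to class functions and acts on them as \<nu> (J -
  I), with J the all-ones matrix of order \<open>c\<close>. This yields the eigenvalues \<nu> (c -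
  1) and -\<nu>. The orthogonal complement consists of the vectors that sum to zero on each class;
  there the complete multipartite graph on the classes acts as zero, so A is minus the adjacency
  matrix of the multipartite complement, which is regular of degree (m - \<nu>) (c - 1). The
  hypothesis on \<nu> says exactly that this degree is at most \<nu>. Hence no eigenvalue lies below
  -\<nu> (\<open>adjacency_form_ge\<close>, \<open>eigenvalue_ge\<close>), and Hoffman's bound
  equals 1 + (c - 1) = c.

  The same inequality for the adjacency form bounds every independent set by \<open>m\<close>
  vertices (\<open>card_independent_set_le\<close>), so \<open>c * m\<close> vertices need at least
  \<open>c\<close> colors (\<open>coloring_ge\<close>). None of this uses connectedness. A component
  inherits the coloring with the same \<open>c\<close> and \<nu> and with a common class size of at
  most \<open>m\<close> (\<open>component\<close>), so the whole argument applies to it and gives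
  values depending only on \<open>c\<close> and \<nu>.\<close>

section \<open>Eigenvalues of the adjacency matrix\<close>

definition (in pre_digraph) adj :: "'a \<Rightarrow> 'a \<Rightarrow> real" where
  "adj u v = of_bool (u \<rightarrow>\<^bsub>G\<^esub> v)"

lemma (in sym_digraph) adj_commute: "adj u v = adj v u"
  using graph_symmetric by (auto simp: adj_def)

lemma (in fin_digraph) vertex_list:
  "distinct (vertex_list G)" "set (vertex_list G) = verts G"
proof -
  have "\<exists>vs. distinct vs \<and> set vs = verts G"
    using finite_distinct_list[OF finite_verts] by blast
  then have "distinct (vertex_list G) \<and> set (vertex_list G) = verts G"
    unfolding vertex_list_def by (rule someI_ex)
  then show "distinct (vertex_list G)" "set (vertex_list G) = verts G" by auto
qed

text \<open>Removes the arbitrary enumeration of the vertices: eigenvectors become functions on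
  vertices, and all later spectral arguments are about sums over \<open>verts G\<close>.\<close>

lemma (in fin_digraph) eigenvalue_adjacency_matrix_iff:
  "eigenvalue (adjacency_matrix G) k \<longleftrightarrow>
     (\<exists>x. (\<exists>v \<in> verts G. x v \<noteq> 0) \<and>
          (\<forall>u \<in> verts G. (\<Sum>v\<in>verts G. adj u v * x v) = k * x u))"
proof -
  define vs where "vs = vertex_list G"
  define n where "n = card (verts G)"
  have len: "length vs = n"
    using vertex_list distinct_card[of vs] by (simp add: vs_def n_def)
  have bij: "bij_betw ((!) vs) {..<n} (verts G)"
    using vertex_list len bij_betw_nth[of vs "{..<n}" "verts G"] by (simp add: vs_def)
  have matrix_eq: "adjacency_matrix G = mat n n (\<lambda>(i, j). adj (vs ! i) (vs ! j))"
    by (simp add: adjacency_matrix_def n_def vs_def adj_def of_bool_def)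
  then have carrier: "adjacency_matrix G \<in> carrier_mat n n" by simp
  have mult: "(adjacency_matrix G *\<^sub>v vec n (\<lambda>i. x (vs ! i))) $ i
      = (\<Sum>v\<in>verts G. adj (vs ! i) v * x v)" if "i < n" for i and x :: "'a \<Rightarrow> real"
  proof -
    have "(adjacency_matrix G *\<^sub>v vec n (\<lambda>i. x (vs ! i))) $ i
        = (\<Sum>j<n. adj (vs ! i) (vs ! j) * x (vs ! j))"
      using that by (simp add: matrix_eq scalar_prod_def atLeast0LessThan)
    also have "\<dots> = (\<Sum>v\<in>verts G. adj (vs ! i) v * x v)"
      by (rule sum.reindex_bij_betw[OF bij])
    finally show ?thesis .
  qed
  have eigenvector_iff: "eigenvector (adjacency_matrix G) (vec n (\<lambda>i. x (vs ! i))) k \<longleftrightarrow>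
      (\<exists>v \<in> verts G. x v \<noteq> 0) \<and>
      (\<forall>u \<in> verts G. (\<Sum>v\<in>verts G. adj u v * x v) = k * x u)" for x :: "'a \<Rightarrow> real"
  proof -
    have "vec n (\<lambda>i. x (vs ! i)) \<noteq> 0\<^sub>v n \<longleftrightarrow> (\<exists>i<n. x (vs ! i) \<noteq> 0)"
      by (auto simp: vec_eq_iff)
    moreover have "adjacency_matrix G *\<^sub>v vec n (\<lambda>i. x (vs ! i)) = k \<cdot>\<^sub>v vec n (\<lambda>i. x (vs ! i)) \<longleftrightarrow>
        (\<forall>i<n. (\<Sum>v\<in>verts G. adj (vs ! i) v * x v) = k * x (vs ! i))"
      using carrier mult by (auto simp: vec_eq_iff)
    ultimately show ?thesis
      using carrier by (auto simp: eigenvector_def bij_betw_imp_surj_on[OF bij, symmetric])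
  qed
  show ?thesis
  proof
    assume "eigenvalue (adjacency_matrix G) k"
    then obtain w where w: "eigenvector (adjacency_matrix G) w k"
      by (auto simp: eigenvalue_def)
    \<comment> \<open>\<open>x\<close> reads the coordinate of \<open>w\<close> at the position of
      \<open>v\<close> in the enumeration, so \<open>w\<close> is recovered from
      \<open>x\<close>.\<close>
    define x where "x v = w $ inv_into {..<n} ((!) vs) v" for v
    have "w = vec n (\<lambda>i. x (vs ! i))"
      using w carrier bij
      by (auto simp: eigenvector_def x_def bij_betw_def inv_into_f_f)
    with w eigenvector_iff show "\<exists>x. (\<exists>v \<in> verts G. x v \<noteq> 0) \<and>
        (\<forall>u \<in> verts G. (\<Sum>v\<in>verts G. adj u v * x v) = k * x u)"
      by metis
  qed (use eigenvector_iff in \<open>unfold eigenvalue_def, blast\<close>)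
qed

text \<open>Needed to evaluate \<open>Max\<close> and \<open>Min\<close> of the spectrum.
  Eigenvalues are roots of the characteristic polynomial, which is monic and hence nonzero.\<close>

lemma (in fin_digraph) finite_eigenvalues_adjacency_matrix:
  "finite {k. eigenvalue (adjacency_matrix G) k}"
proof -
  define n where "n = card (verts G)"
  have carrier: "adjacency_matrix G \<in> carrier_mat n n"
    by (simp add: adjacency_matrix_def n_def)
  then have "char_poly (adjacency_matrix G) \<noteq> 0"
    using degree_monic_char_poly[OF carrier] by auto
  then show ?thesis
    using poly_roots_finite by (simp add: eigenvalue_root_char_poly[OF carrier])
qed

text \<open>At a vertex where the absolute value of the eigenvector attains its maximum
  \<open>M\<close>, the eigenvalue equation and nonnegativity of \<open>adj\<close> give
  \<open>k * M \<le> d * M\<close>.\<close>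

lemma (in fin_digraph) eigenvalue_le_max_degree:
  assumes "eigenvalue (adjacency_matrix G) k"
    and degree: "\<And>u. u \<in> verts G \<Longrightarrow> (\<Sum>v\<in>verts G. adj u v) \<le> d"
  shows "k \<le> d"
proof -
  obtain x where nz: "\<exists>v \<in> verts G. x v \<noteq> 0"
    and x: "\<And>u. u \<in> verts G \<Longrightarrow> (\<Sum>v\<in>verts G. adj u v * x v) = k * x u"
    using assms(1) unfolding eigenvalue_adjacency_matrix_iff by blast
  define M where "M = Max ((\<lambda>v. \<bar>x v\<bar>) ` verts G)"
  have M: "\<bar>x v\<bar> \<le> M" if "v \<in> verts G" for v
    using that by (auto simp: M_def)
  have "M \<in> (\<lambda>v. \<bar>x v\<bar>) ` verts G"
    unfolding M_def using nz by (intro Max_in) auto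
  then obtain u where u: "u \<in> verts G" "\<bar>x u\<bar> = M" by auto
  have "M > 0" using nz M by (metis abs_le_zero_iff linorder_not_less order_less_le_trans zero_less_abs_iff)
  have "k * M \<le> \<bar>k * x u\<bar>"
    using u by (simp add: abs_mult mult_right_mono flip: u(2))
  also have "\<dots> = \<bar>\<Sum>v\<in>verts G. adj u v * x v\<bar>" using x u by simp
  also have "\<dots> \<le> (\<Sum>v\<in>verts G. \<bar>adj u v * x v\<bar>)" by (rule sum_abs)
  also have "\<dots> \<le> (\<Sum>v\<in>verts G. adj u v * M)"
    by (intro sum_mono) (simp add: M adj_def)
  also have "\<dots> = (\<Sum>v\<in>verts G. adj u v) * M" by (simp add: sum_distrib_right)
  also have "\<dots> \<le> d * M" using degree[OF u(1)] \<open>M > 0\<close> by (intro mult_right_mono) auto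
  finally show ?thesis using \<open>M > 0\<close> by simp
qed

section \<open>The adjacency form of an equitably colored graph\<close>

text \<open>The hypotheses form a locale so that each component can be interpreted as a further
  instance, with its own class size in place of \<open>m\<close>.\<close>

locale equitably_colored_graph = graph G for G :: "('v, 'e) pre_digraph" (structure) +
  fixes c m \<nu> :: nat and f :: "'v \<Rightarrow> nat"
  assumes two_le_c: "c \<ge> 2"
    and equitable: "equitable_coloring G \<nu> c f"
    and card_class: "\<And>i. i < c \<Longrightarrow> card (color_class G f i) = m"
    and \<nu>_ge: "real \<nu> \<ge> real m * (real c - 1) / real c"
begin

section \<open>Sums over color classes\<close>

lemma coloring: "coloring G c f"
  using equitable by (simp add: equitable_coloring_def)

lemma color_less: "u \<in> verts G \<Longrightarrow> f u < c"
  using coloring by (auto simp: coloring_def)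

lemma color_ne: "u \<rightarrow>\<^bsub>G\<^esub> v \<Longrightarrow> f u \<noteq> f v"
  using coloring adj_in_verts unfolding coloring_def proper_coloring_def by blast

lemma finite_class [simp]: "finite (color_class G g i)"
  by (simp add: color_class_def)

lemma m_pos: "m > 0"
proof -
  have "0 \<in> f ` verts G" using coloring two_le_c by (auto simp: coloring_def)
  then have "color_class G f 0 \<noteq> {}" by (auto simp: color_class_def)
  then show ?thesis using card_class[of 0] two_le_c by (metis card_gt_0_iff finite_class gr0I less_le_trans not_numeral_le_zero le_zero_eq)
qed

lemma \<nu>_pos: "\<nu> > 0"
proof -
  have "real m * (real c - 1) / real c > 0" using m_pos two_le_c by simp
  then have "real \<nu> > 0" using \<nu>_ge by linarith
  then show ?thesis by simp
qed

lemma sum_verts_by_class: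
  fixes g :: "'v \<Rightarrow> real"
  shows "(\<Sum>v\<in>verts G. g v) = (\<Sum>i<c. \<Sum>v\<in>color_class G f i. g v)"
  unfolding color_class_def
  by (rule sum.group[symmetric]) (use color_less in auto)

lemma sum_class_function:
  fixes F :: "nat \<Rightarrow> real" and g :: "'v \<Rightarrow> real"
  shows "(\<Sum>v\<in>verts G. F (f v) * g v) = (\<Sum>i<c. F i * (\<Sum>v\<in>color_class G f i. g v))"
  unfolding sum_verts_by_class sum_distrib_left
  by (intro sum.cong refl) (auto simp: color_class_def)

lemma sum_adj_class:
  assumes "u \<in> verts G" "i < c"
  shows "(\<Sum>v\<in>color_class G f i. adj u v) = (if i = f u then 0 else real \<nu>)"
proof -
  have "(\<Sum>v\<in>color_class G f i. adj u v) = real (card {w \<in> color_class G f i. u \<rightarrow>\<^bsub>G\<^esub> w})"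
    by (simp add: adj_def Int_def)
  also have "\<dots> = (if i = f u then 0 else real \<nu>)"
  proof (cases "i = f u")
    case True
    then have "{w \<in> color_class G f i. u \<rightarrow>\<^bsub>G\<^esub> w} = {}"
      using color_ne[of u] by (force simp: color_class_def)
    then show ?thesis using True by (simp only: card.empty) simp
  qed (use equitable assms in \<open>auto simp: equitable_coloring_def\<close>)
  finally show ?thesis .
qed

text \<open>The equitable partition at work: on functions of the color, the adjacency operator is
  the quotient matrix \<nu> (J - I).\<close>

lemma sum_adj_class_function:
  fixes F :: "nat \<Rightarrow> real"
  assumes "u \<in> verts G"
  shows "(\<Sum>v\<in>verts G. adj u v * F (f v)) = \<nu> * ((\<Sum>i<c. F i) - F (f u))"
proof -
  have "(\<Sum>v\<in>verts G. adj u v * F (f v)) = (\<Sum>i<c. F i * (if i = f u then 0 else real \<nu>))"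
    using sum_class_function[of F "adj u"] sum_adj_class[OF assms] by (simp add: mult.commute)
  also have "\<dots> = (\<Sum>i<c. \<nu> * F i - (if i = f u then \<nu> * F (f u) else 0))"
    by (intro sum.cong) auto
  also have "\<dots> = \<nu> * ((\<Sum>i<c. F i) - F (f u))"
    using color_less[OF assms] by (simp add: sum_subtractf sum_distrib_left right_diff_distrib)
  finally show ?thesis .
qed

lemma degree: "u \<in> verts G \<Longrightarrow> (\<Sum>v\<in>verts G. adj u v) = \<nu> * (real c - 1)"
  using sum_adj_class_function[of u "\<lambda>_. 1"] by simp

lemma card_verts: "card (verts G) = c * m"
proof -
  have "real (card (verts G)) = real (c * m)"
    using sum_verts_by_class[of "\<lambda>_. 1"] card_class by simp
  then show ?thesis by (simp only: of_nat_eq_iff)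
qed

section \<open>Lower bound for the adjacency form\<close>

text \<open>On vectors that sum to zero on each class, the adjacency form is the negative of the form of
  the multipartite complement, which is regular of degree \<open>(m - \<nu>) (c - 1) \<le> \<nu>\<close>.\<close>

lemma adjacency_form_centered_ge:
  fixes z :: "'v \<Rightarrow> real"
  assumes centered: "\<And>i. i < c \<Longrightarrow> (\<Sum>v\<in>color_class G f i. z v) = 0"
  shows "(\<Sum>u\<in>verts G. \<Sum>v\<in>verts G. adj u v * z u * z v) \<ge> - real \<nu> * (\<Sum>u\<in>verts G. (z u)\<^sup>2)"
proof -
  \<comment> \<open>\<open>b\<close> is the adjacency function of the multipartite complement, and
    \<open>d\<close> its common row sum.\<close>
  define b where "b u v = of_bool (f u \<noteq> f v) - adj u v" for u v
  define d where "d = (real m - \<nu>) * (real c - 1)"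
  have b_nonneg: "b u v \<ge> 0" for u v
    using color_ne[of u v] by (auto simp: b_def adj_def)
  have b_commute: "b u v = b v u" for u v
    unfolding b_def using adj_commute[of u v] by (simp add: eq_commute)
  have row: "(\<Sum>v\<in>verts G. b u v) = d" if "u \<in> verts G" for u
  proof -
    have "(\<Sum>v\<in>verts G. of_bool (f u \<noteq> f v) :: real)
        = (\<Sum>i<c. of_bool (f u \<noteq> i) * (\<Sum>v\<in>color_class G f i. 1))"
      using sum_class_function[of "\<lambda>i. of_bool (f u \<noteq> i)" "\<lambda>_. 1"] by simp
    also have "\<dots> = (\<Sum>i<c. m - (if i = f u then real m else 0))"
      by (intro sum.cong) (auto simp: card_class)
    also have "\<dots> = m * (real c - 1)"
      using color_less[OF that] by (simp add: sum_subtractf algebra_simps)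
    finally show ?thesis
      using degree[OF that] by (simp add: b_def d_def sum_subtractf algebra_simps)
  qed
  \<comment> \<open>For fixed \<open>u\<close>, \<open>of_bool (f u \<noteq> f v)\<close> depends
    only on the color of \<open>v\<close>, so the form of the complete multipartite graph vanishes
    at \<open>z\<close>.\<close>
  have class_sum: "(\<Sum>v\<in>verts G. F (f v) * z v) = 0" for F
    unfolding sum_class_function using centered by simp
  have "(\<Sum>u\<in>verts G. \<Sum>v\<in>verts G. of_bool (f u \<noteq> f v) * z u * z v)
      = (\<Sum>u\<in>verts G. z u * (\<Sum>v\<in>verts G. of_bool (f u \<noteq> f v) * z v))"
    unfolding sum_distrib_left by (intro sum.cong refl) simp
  also have "\<dots> = 0"
  proof (intro sum.neutral ballI)
    fix u
    show "z u * (\<Sum>v\<in>verts G. of_bool (f u \<noteq> f v) * z v) = 0"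
      by (simp only: class_sum[of "\<lambda>i. of_bool (f u \<noteq> i)"] mult_zero_right)
  qed
  finally have form_b: "(\<Sum>u\<in>verts G. \<Sum>v\<in>verts G. adj u v * z u * z v)
      = - (\<Sum>u\<in>verts G. \<Sum>v\<in>verts G. b u v * z u * z v)"
    by (simp add: b_def left_diff_distrib sum_subtractf)
  have sq: "(\<Sum>u\<in>verts G. \<Sum>v\<in>verts G. b u v * (z u)\<^sup>2) = d * (\<Sum>u\<in>verts G. (z u)\<^sup>2)"
    by (simp add: row sum_distrib_left flip: sum_distrib_right)
  have sq': "(\<Sum>u\<in>verts G. \<Sum>v\<in>verts G. b u v * (z v)\<^sup>2) = d * (\<Sum>u\<in>verts G. (z u)\<^sup>2)"
    by (subst sum.swap, subst b_commute, rule sq)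
  \<comment> \<open>Nonnegativity of the Laplacian form of \<open>b\<close>; expanding the square
    bounds the form of \<open>b\<close> by its degree \<open>d\<close>.\<close>
  have "0 \<le> (\<Sum>u\<in>verts G. \<Sum>v\<in>verts G. b u v * (z u - z v)\<^sup>2)"
    by (intro sum_nonneg mult_nonneg_nonneg b_nonneg) auto
  also have "\<dots> = (\<Sum>u\<in>verts G. \<Sum>v\<in>verts G.
      b u v * (z u)\<^sup>2 + b u v * (z v)\<^sup>2 - 2 * (b u v * z u * z v))"
    by (simp add: power2_diff algebra_simps)
  also have "\<dots> = 2 * d * (\<Sum>u\<in>verts G. (z u)\<^sup>2)
      - 2 * (\<Sum>u\<in>verts G. \<Sum>v\<in>verts G. b u v * z u * z v)"
    by (simp only: sum_subtractf sum.distrib sq sq' flip: sum_distrib_left)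
  finally have "(\<Sum>u\<in>verts G. \<Sum>v\<in>verts G. b u v * z u * z v) \<le> d * (\<Sum>u\<in>verts G. (z u)\<^sup>2)"
    by simp
  \<comment> \<open>The hypothesis on \<nu>, rearranged: (m - \<nu>) (c - 1) \<le> \<nu> iff m (c -
    1) \<le> \<nu> c.\<close>
  moreover have "d \<le> \<nu>"
    using \<nu>_ge two_le_c by (simp add: d_def field_simps)
  then have "d * (\<Sum>u\<in>verts G. (z u)\<^sup>2) \<le> \<nu> * (\<Sum>u\<in>verts G. (z u)\<^sup>2)"
    by (intro mult_right_mono sum_nonneg) auto
  ultimately show ?thesis using form_b by linarith
qed

text \<open>Split \<open>x\<close> orthogonally into its class averages and a centered remainder.
  The cross terms of the form vanish, the averages contribute at least -\<nu> times their squared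
  norm by a direct computation, and the remainder is covered by
  \<open>adjacency_form_centered_ge\<close>.\<close>

lemma adjacency_form_ge:
  fixes x :: "'v \<Rightarrow> real"
  shows "(\<Sum>u\<in>verts G. \<Sum>v\<in>verts G. adj u v * x u * x v) \<ge> - real \<nu> * (\<Sum>u\<in>verts G. (x u)\<^sup>2)"
proof -
  define F where "F i = (\<Sum>v\<in>color_class G f i. x v) / m" for i
  define z where "z v = x v - F (f v)" for v
  define T where "T = (\<Sum>i<c. F i)"
  define P where "P i = \<nu> * (T - F i)" for i
  have x_eq: "x v = F (f v) + z v" for v by (simp add: z_def)
  have centered: "(\<Sum>v\<in>color_class G f i. z v) = 0" if "i < c" for i
  proof -
    have "(\<Sum>v\<in>color_class G f i. z v) = (\<Sum>v\<in>color_class G f i. x v - F i)"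
      by (intro sum.cong) (auto simp: z_def color_class_def)
    also have "\<dots> = 0"
      using m_pos card_class[OF that] by (simp add: sum_subtractf F_def)
    finally show ?thesis .
  qed
  have orth: "(\<Sum>v\<in>verts G. H (f v) * z v) = 0" for H
    unfolding sum_class_function using centered by simp
  have adj_F: "(\<Sum>v\<in>verts G. adj u v * F (f v)) = P (f u)" if "u \<in> verts G" for u
    using sum_adj_class_function[OF that] by (simp add: P_def T_def)
  have FF: "(\<Sum>u\<in>verts G. \<Sum>v\<in>verts G. adj u v * F (f u) * F (f v))
      = \<nu> * m * T\<^sup>2 - real \<nu> * (\<Sum>u\<in>verts G. (F (f u))\<^sup>2)"
  proof -
    have "(\<Sum>u\<in>verts G. \<Sum>v\<in>verts G. adj u v * F (f u) * F (f v))
        = (\<Sum>u\<in>verts G. F (f u) * (\<Sum>v\<in>verts G. adj u v * F (f v)))"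
      by (simp add: sum_distrib_left mult_ac)
    also have "\<dots> = (\<Sum>u\<in>verts G. F (f u) * P (f u))" by (simp add: adj_F)
    also have "\<dots> = \<nu> * T * (\<Sum>u\<in>verts G. F (f u)) - real \<nu> * (\<Sum>u\<in>verts G. (F (f u))\<^sup>2)"
      by (simp add: P_def algebra_simps power2_eq_square sum_subtractf sum_distrib_left)
    also have "(\<Sum>u\<in>verts G. F (f u)) = m * T"
      using sum_class_function[of F "\<lambda>_. 1"] card_class by (simp add: T_def sum_distrib_left mult_ac)
    finally show ?thesis by (simp add: power2_eq_square)
  qed
  \<comment> \<open>The adjacency operator sends \<open>F o f\<close> to the class function
    \<open>P o f\<close>, which is orthogonal to the centered \<open>z\<close>.\<close>
  have zF: "(\<Sum>u\<in>verts G. \<Sum>v\<in>verts G. adj u v * z u * F (f v)) = 0"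
  proof -
    have "(\<Sum>u\<in>verts G. \<Sum>v\<in>verts G. adj u v * z u * F (f v))
        = (\<Sum>u\<in>verts G. z u * (\<Sum>v\<in>verts G. adj u v * F (f v)))"
      by (simp add: sum_distrib_left mult_ac)
    also have "\<dots> = (\<Sum>u\<in>verts G. P (f u) * z u)" by (intro sum.cong refl) (simp add: adj_F)
    finally show ?thesis by (simp add: orth)
  qed
  have Fz: "(\<Sum>u\<in>verts G. \<Sum>v\<in>verts G. adj u v * F (f u) * z v) = 0"
  proof -
    have "(\<Sum>u\<in>verts G. \<Sum>v\<in>verts G. adj u v * F (f u) * z v)
        = (\<Sum>v\<in>verts G. \<Sum>u\<in>verts G. adj v u * z v * F (f u))"
      by (subst sum.swap, subst adj_commute) (simp add: mult_ac)
    then show ?thesis using zF by simp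
  qed
  have sq: "(\<Sum>u\<in>verts G. (x u)\<^sup>2) = (\<Sum>u\<in>verts G. (F (f u))\<^sup>2) + (\<Sum>u\<in>verts G. (z u)\<^sup>2)"
  proof -
    have "(\<Sum>u\<in>verts G. (x u)\<^sup>2)
        = (\<Sum>u\<in>verts G. (F (f u))\<^sup>2 + (z u)\<^sup>2 + 2 * (F (f u) * z u))"
      by (simp add: x_eq power2_sum mult_ac)
    then show ?thesis
      by (simp only: sum.distrib orth mult_zero_right add_0_right flip: sum_distrib_left)
  qed
  have "(\<Sum>u\<in>verts G. \<Sum>v\<in>verts G. adj u v * x u * x v)
      = (\<Sum>u\<in>verts G. \<Sum>v\<in>verts G. adj u v * F (f u) * F (f v) + adj u v * F (f u) * z v
          + adj u v * z u * F (f v) + adj u v * z u * z v)"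
    by (intro sum.cong refl) (simp add: x_eq algebra_simps)
  also have "\<dots> = \<nu> * m * T\<^sup>2 - real \<nu> * (\<Sum>u\<in>verts G. (F (f u))\<^sup>2)
      + (\<Sum>u\<in>verts G. \<Sum>v\<in>verts G. adj u v * z u * z v)"
    by (simp only: sum.distrib FF zF Fz)
  also have "\<dots> \<ge> - real \<nu> * (\<Sum>u\<in>verts G. (x u)\<^sup>2)"
  proof -
    have "0 \<le> \<nu> * m * T\<^sup>2" by simp
    then show ?thesis
      using adjacency_form_centered_ge[of z, OF centered] unfolding sq distrib_left by linarith
  qed
  finally show ?thesis .
qed

section \<open>Spectrum and chromatic number\<close>

lemma eigenvalue_ge:
  assumes "eigenvalue (adjacency_matrix G) k"
  shows "k \<ge> - real \<nu>"
proof -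
  obtain x where nz: "\<exists>v \<in> verts G. x v \<noteq> 0"
    and x: "\<And>u. u \<in> verts G \<Longrightarrow> (\<Sum>v\<in>verts G. adj u v * x v) = k * x u"
    using assms unfolding eigenvalue_adjacency_matrix_iff by blast
  have "(\<Sum>u\<in>verts G. \<Sum>v\<in>verts G. adj u v * x u * x v)
      = (\<Sum>u\<in>verts G. x u * (\<Sum>v\<in>verts G. adj u v * x v))"
    by (simp add: sum_distrib_left mult_ac)
  also have "\<dots> = k * (\<Sum>u\<in>verts G. (x u)\<^sup>2)"
    unfolding sum_distrib_left[of k] by (intro sum.cong refl) (simp add: x power2_eq_square)
  finally have "- real \<nu> * (\<Sum>u\<in>verts G. (x u)\<^sup>2) \<le> k * (\<Sum>u\<in>verts G. (x u)\<^sup>2)"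
    using adjacency_form_ge[of x] by simp
  moreover have "(\<Sum>u\<in>verts G. (x u)\<^sup>2) > 0"
    using nz by (auto intro: sum_pos2)
  ultimately show ?thesis by (simp only: mult_le_cancel_right_pos)
qed

text \<open>Eigenvectors of the quotient matrix lift to the graph. Color 0 is used, so
  \<open>F 0 \<noteq> 0\<close> keeps the lift nonzero.\<close>

lemma eigenvalue_class_function:
  fixes F :: "nat \<Rightarrow> real"
  assumes "\<And>i. i < c \<Longrightarrow> \<nu> * ((\<Sum>j<c. F j) - F i) = k * F i" and "F 0 \<noteq> 0"
  shows "eigenvalue (adjacency_matrix G) k"
proof -
  have "0 \<in> f ` verts G" using coloring two_le_c by (auto simp: coloring_def)
  then have "\<exists>v \<in> verts G. F (f v) \<noteq> 0" using assms(2) by (metis imageE)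
  moreover have "(\<Sum>v\<in>verts G. adj u v * F (f v)) = k * F (f u)" if "u \<in> verts G" for u
    using assms(1)[OF color_less[OF that]] sum_adj_class_function[OF that, of F] by simp
  ultimately show ?thesis unfolding eigenvalue_adjacency_matrix_iff by (intro exI[of _ "\<lambda>v. F (f v)"]) auto
qed

lemma lambda_max_eq: "lambda_max G = \<nu> * (real c - 1)"
  unfolding lambda_max_def
proof (rule Max_eqI[OF finite_eigenvalues_adjacency_matrix])
  show "\<nu> * (real c - 1) \<in> {k. eigenvalue (adjacency_matrix G) k}"
    using eigenvalue_class_function[of "\<lambda>_. 1"] by simp
qed (use eigenvalue_le_max_degree degree in fastforce)

lemma lambda_min_eq: "lambda_min G = - real \<nu>"
  unfolding lambda_min_def
proof (rule Min_eqI[OF finite_eigenvalues_adjacency_matrix])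
  \<comment> \<open>The indicator of color 0 minus that of color 1: its entries sum to zero, so
    \<nu> (J - I) multiplies it by -\<nu>. Both colors exist since \<open>c \<ge> 2\<close>.\<close>
  define F :: "nat \<Rightarrow> real" where "F i = of_bool (i = 0) - of_bool (i = 1)" for i
  have "(\<Sum>i<c. F i) = 0"
    using two_le_c by (simp add: F_def sum_subtractf of_bool_def)
  then show "- real \<nu> \<in> {k. eigenvalue (adjacency_matrix G) k}"
    using eigenvalue_class_function[of F "- real \<nu>"] by (simp add: F_def)
qed (use eigenvalue_ge in auto)

section \<open>Independent sets and the chromatic number\<close>

text \<open>Hoffman's ratio bound, from the adjacency form at the centered indicator function of \<open>S\<close>.\<close>

lemma card_independent_set_le:
  assumes S: "S \<subseteq> verts G" and independent: "\<And>u v. u \<in> S \<Longrightarrow> v \<in> S \<Longrightarrow> \<not> u \<rightarrow>\<^bsub>G\<^esub> v"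
  shows "card S \<le> m"
proof (cases "S = {}")
  case False
  define s where "s = real (card S)"
  define n where "n = real (card (verts G))"
  \<comment> \<open>The mean of the indicator \<open>e\<close>; subtracting it makes the test vector
    orthogonal to the constants.\<close>
  define t where "t = s / n"
  define d where "d = \<nu> * (real c - 1)"
  define e :: "'v \<Rightarrow> real" where "e u = of_bool (u \<in> S)" for u
  have n: "n = real c * real m" by (simp add: n_def card_verts)
  have "n > 0" using m_pos two_le_c by (simp add: n)
  have "s > 0"
    using False S finite_subset[OF S] by (simp add: s_def card_gt_0_iff)
  have sum_e: "(\<Sum>u\<in>verts G. e u) = s"
    using S by (simp add: e_def s_def of_bool_def sum.If_cases Int_absorb1 Int_def[symmetric])
  have e_sq: "(e u)\<^sup>2 = e u" for u by (simp add: e_def)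
  have row: "(\<Sum>u\<in>verts G. \<Sum>v\<in>verts G. adj u v * e u) = d * s"
    by (simp add: degree d_def sum_e flip: sum_distrib_left sum_distrib_right)
  have col: "(\<Sum>u\<in>verts G. \<Sum>v\<in>verts G. adj u v * e v) = d * s"
    by (subst sum.swap, subst adj_commute, rule row)
  have all: "(\<Sum>u\<in>verts G. \<Sum>v\<in>verts G. adj u v) = d * n"
    by (simp add: degree d_def n_def)
  have "adj u v * e u * e v = 0" for u v
    using independent by (auto simp: e_def adj_def)
  then have "(\<Sum>u\<in>verts G. \<Sum>v\<in>verts G. adj u v * (e u - t) * (e v - t))
      = (\<Sum>u\<in>verts G. \<Sum>v\<in>verts G. t\<^sup>2 * adj u v - t * (adj u v * e u) - t * (adj u v * e v))"
    by (intro sum.cong refl) (simp add: algebra_simps power2_eq_square)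
  also have "\<dots> = t\<^sup>2 * (d * n) - t * (d * s) - t * (d * s)"
    by (simp only: sum_subtractf row col all flip: sum_distrib_left)
  also have "\<dots> = - t * d * s"
    using \<open>n > 0\<close> by (simp add: t_def power2_eq_square)
  finally have form: "(\<Sum>u\<in>verts G. \<Sum>v\<in>verts G. adj u v * (e u - t) * (e v - t)) = - t * d * s" .
  have "(\<Sum>u\<in>verts G. (e u - t)\<^sup>2) = (\<Sum>u\<in>verts G. e u - 2 * t * e u + t\<^sup>2)"
    by (intro sum.cong refl) (simp add: power2_diff e_sq)
  also have "\<dots> = s - 2 * t * s + n * t\<^sup>2"
    by (simp add: sum.distrib sum_subtractf sum_e n_def flip: sum_distrib_left)
  also have "\<dots> = s - t * s"
    using \<open>n > 0\<close> by (simp add: t_def power2_eq_square)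
  finally have "- real \<nu> * (s - t * s) \<le> - t * d * s"
    using adjacency_form_ge[of "\<lambda>u. e u - t"] form by simp
  \<comment> \<open>With d = \<nu> (c - 1), the terms in \<open>t\<close> combine to t c \<nu> s; as
    t = s / (c m), cancelling \<nu> s leaves s \<le> m.\<close>
  then have "(t * real c) * (\<nu> * s) \<le> 1 * (\<nu> * s)"
    by (simp add: d_def algebra_simps)
  then have "t * real c \<le> 1"
    using \<nu>_pos \<open>s > 0\<close> by (subst (asm) mult_le_cancel_right_pos) auto
  then have "s \<le> real m"
    using m_pos two_le_c by (simp add: t_def n field_simps)
  then show ?thesis by (simp add: s_def)
qed simp

text \<open>The classes of any proper coloring are independent, so \<open>k\<close> of them cover at
  most \<open>k * m\<close> of the \<open>c * m\<close> vertices.\<close>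

lemma coloring_ge:
  assumes "coloring G k g"
  shows "c \<le> k"
proof -
  have "c * m = card (\<Union>i<k. color_class G g i)"
    unfolding card_verts[symmetric]
    using assms by (intro arg_cong[of _ _ card]) (auto simp: coloring_def color_class_def)
  also have "\<dots> \<le> (\<Sum>i<k. card (color_class G g i))"
    by (rule card_UN_le) simp
  also have "\<dots> \<le> (\<Sum>i<k. m)"
    using assms
    by (intro sum_mono card_independent_set_le)
      (simp_all add: color_class_def coloring_def proper_coloring_def Collect_mono, metis)
  also have "\<dots> = k * m" by simp
  finally show ?thesis using m_pos by simp
qed

lemma chromatic_number_eq: "chromatic_number G = c"
  unfolding chromatic_number_def
  using coloring coloring_ge by (intro Least_equality) auto

section \<open>Equality in Hoffman's bound\<close>

lemma hoffman_bound_eq: "hoffman_bound G = c"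
  using \<nu>_pos by (simp add: hoffman_bound_def lambda_max_eq lambda_min_eq)

lemma verts_nonempty: "verts G \<noteq> {}"
  using m_pos two_le_c card_verts by force

lemma arcs_nonempty: "arcs G \<noteq> {}"
proof
  assume "arcs G = {}"
  then have "adj u v = 0" for u v by (auto simp: adj_def arcs_ends_def)
  moreover obtain u where "u \<in> verts G" using verts_nonempty by blast
  ultimately have "\<nu> * (real c - 1) = 0" using degree by simp
  then show False using \<nu>_pos two_le_c by simp
qed

lemma connected_hoffman_colorable_iff:
  "connected_hoffman_colorable G \<longleftrightarrow> Digraph_Component.connected G"
  by (simp add: connected_hoffman_colorable_def arcs_nonempty hoffman_bound_eq chromatic_number_eq)

section \<open>Components\<close>

lemma neighbor_of_color:
  assumes "u \<in> verts G" "i < c" "i \<noteq> f u"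
  obtains w where "w \<in> color_class G f i" "u \<rightarrow>\<^bsub>G\<^esub> w"
proof -
  have "card {w \<in> color_class G f i. u \<rightarrow>\<^bsub>G\<^esub> w} = \<nu>"
    using equitable assms by (auto simp: equitable_coloring_def)
  then have "{w \<in> color_class G f i. u \<rightarrow>\<^bsub>G\<^esub> w} \<noteq> {}"
    using \<nu>_pos by (metis card.empty less_numeral_extra(3))
  then show ?thesis using that by auto
qed

text \<open>Counting the edges between two classes inside a component shows that the classes of the
  component all have the same size; it is at most \<open>m\<close>, so the bound on \<open>\<nu>\<close> is inherited.\<close>

lemma component:
  assumes H: "H \<in> sccs"
  shows "graph H" and "Digraph_Component.connected H"
    and "equitably_colored_graph H c (card (color_class H f 0)) \<nu> f"
proof -
  have ind: "induced_subgraph H G" and sc: "strongly_connected H"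
    using H by (auto simp: sccs_def)
  have sub: "verts H \<subseteq> verts G" using ind by auto
  show graph_H: "graph H"
    using digraph.graphI[OF digraphI_induced[OF ind]] induced_graph_imp_symmetric[OF sym_arcs ind] .
  interpret H: graph H by (rule graph_H)
  \<comment> \<open>The arcs are symmetric, so passing to the symmetric closure does not change
    reachability.\<close>
  show "Digraph_Component.connected H"
    using sc H.reachable_mk_symmetric_eq[OF H.sym_arcs]
    by (simp add: Digraph_Component.connected_def strongly_connected_def)
  have adj_H: "u \<rightarrow>\<^bsub>H\<^esub> v \<longleftrightarrow> u \<rightarrow>\<^bsub>G\<^esub> v" if "u \<in> verts H" "v \<in> verts H" for u v
  proof -
    have "u \<rightarrow>\<^bsub>G \<restriction> verts H\<^esub> v \<longleftrightarrow> u \<rightarrow>\<^bsub>G\<^esub> v"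
      using that by (auto simp: arcs_ends_conv)
    then show ?thesis by (simp add: induce_eq_iff_induced[OF ind])
  qed
  \<comment> \<open>A component contains all neighbors of its vertices, so the neighbor counts \<nu>
    carry over unchanged.\<close>
  have closed: "v \<in> verts H" if "u \<in> verts H" "u \<rightarrow>\<^bsub>G\<^esub> v" for u v
  proof -
    have "verts H \<in> sccs_verts" using H by (simp add: sccs_verts_conv)
    moreover have "u \<rightarrow>\<^sup>* v" "v \<rightarrow>\<^sup>* u"
      using that(2) graph_symmetric by (auto intro: reachable_adjI)
    ultimately show ?thesis using that(1) unfolding in_sccs_verts_conv_reachable by blast
  qed
  have nbrs: "{w \<in> color_class H f i. u \<rightarrow>\<^bsub>H\<^esub> w} = {w \<in> color_class G f i. u \<rightarrow>\<^bsub>G\<^esub> w}"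
    if "u \<in> verts H" for u i
    using that sub adj_H closed by (auto simp: color_class_def)
  have proper: "proper_coloring H f"
    using color_ne adj_H by (auto simp: proper_coloring_def)
  obtain u where u: "u \<in> verts H" using sc by (auto simp: strongly_connected_def)
  \<comment> \<open>Since \<nu> > 0, one vertex of the component already has neighbors of every
    other color.\<close>
  have "i \<in> f ` verts H" if "i < c" for i
  proof (cases "i = f u")
    case False
    with u sub that obtain w where "w \<in> color_class G f i" "u \<rightarrow>\<^bsub>G\<^esub> w"
      using neighbor_of_color[of u i] by blast
    then show ?thesis using closed[OF u] by (auto simp: color_class_def)
  qed (use u in auto)
  then have "f ` verts H = {..<c}" using color_less sub by auto
  then have equitable_H: "equitable_coloring H \<nu> c f"
    using equitable proper sub by (auto simp: equitable_coloring_def coloring_def nbrs)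
  have finite_H [simp]: "finite (color_class H f i)" for i
    by (simp add: color_class_def)
  have card_eq: "card (color_class H f i) = card (color_class H f 0)" if "i < c" for i
  proof (cases "i = 0")
    case False
    have deg: "(\<Sum>w\<in>color_class H f j. H.adj u w) = \<nu>"
      if "u \<in> verts H" "j < c" "j \<noteq> f u" for u j
    proof -
      have "(\<Sum>w\<in>color_class H f j. H.adj u w) = card {w \<in> color_class H f j. u \<rightarrow>\<^bsub>H\<^esub> w}"
        by (simp add: H.adj_def Int_def)
      then show ?thesis using equitable_H that by (auto simp: equitable_coloring_def)
    qed
    have "\<nu> * real (card (color_class H f i))
        = (\<Sum>u\<in>color_class H f i. \<Sum>w\<in>color_class H f 0. H.adj u w)"
    proof -
      have "(\<Sum>w\<in>color_class H f 0. H.adj u w) = \<nu>" if "u \<in> color_class H f i" for u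
        using that False two_le_c by (intro deg) (auto simp: color_class_def)
      then show ?thesis by simp
    qed
    also have "\<dots> = (\<Sum>w\<in>color_class H f 0. \<Sum>u\<in>color_class H f i. H.adj u w)"
      by (rule sum.swap)
    also have "\<dots> = (\<Sum>w\<in>color_class H f 0. \<Sum>u\<in>color_class H f i. H.adj w u)"
      by (intro sum.cong refl H.adj_commute)
    also have "\<dots> = \<nu> * real (card (color_class H f 0))"
    proof -
      have "(\<Sum>u\<in>color_class H f i. H.adj w u) = \<nu>" if "w \<in> color_class H f 0" for w
        using that False \<open>i < c\<close> by (intro deg) (auto simp: color_class_def)
      then show ?thesis by simp
    qed
    finally show ?thesis using \<nu>_pos by simp
  qed simp
  have "card (color_class H f 0) \<le> m"
    using card_class[of 0] two_le_c card_mono[of "color_class G f 0" "color_class H f 0"] sub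
    by (auto simp: color_class_def)
  then have "real (card (color_class H f 0)) * (real c - 1) / real c \<le> real m * (real c - 1) / real c"
    using two_le_c by (intro divide_right_mono mult_right_mono) auto
  with \<nu>_ge have \<nu>_ge_H: "real (card (color_class H f 0)) * (real c - 1) / real c \<le> \<nu>" by linarith
  show "equitably_colored_graph H c (card (color_class H f 0)) \<nu> f"
    by (intro equitably_colored_graph.intro equitably_colored_graph_axioms.intro graph_H two_le_c
        equitable_H card_eq \<nu>_ge_H)
qed

text \<open>Class sizes may differ between components, but both extreme eigenvalues and the
  chromatic number depend only on \<open>c\<close> and \<nu>, so they agree.\<close>

lemma hoffman_colorable: "hoffman_colorable G"
proof (cases "Digraph_Component.connected G")
  case True
  then show ?thesis by (simp add: hoffman_colorable_def connected_hoffman_colorable_iff)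
next
  case False
  have "connected_hoffman_colorable H \<and> lambda_max H = \<nu> * (real c - 1) \<and> lambda_min H = - real \<nu> \<and>
      chromatic_number H = c" if "H \<in> sccs" for H
  proof -
    interpret H: equitably_colored_graph H c "card (color_class H f 0)" \<nu> f
      using component(3)[OF that] .
    show ?thesis
      using component(2)[OF that] H.connected_hoffman_colorable_iff H.lambda_max_eq
        H.lambda_min_eq H.chromatic_number_eq by simp
  qed
  then show ?thesis
    using False verts_nonempty
    by (simp add: hoffman_colorable_def disconnected_hoffman_colorable_def)
qed

end

theorem proposition4p2:
  fixes G :: "('v, 'e) pre_digraph" and c m \<nu> :: nat and f :: "'v \<Rightarrow> nat"
  assumes "graph G"
    and "c \<ge> 2"
    and "equitable_coloring G \<nu> c f"
    and "\<And>i. i < c \<Longrightarrow> card (color_class G f i) = m"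
    and "real \<nu> \<ge> real m * (real c - 1) / real c"
  shows "hoffman_colorable G \<and> chromatic_number G = c"
proof -
  interpret equitably_colored_graph G c m \<nu> f
    using assms by (intro equitably_colored_graph.intro equitably_colored_graph_axioms.intro) auto
  show ?thesis using hoffman_colorable chromatic_number_eq by simp
qed

end
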